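(* Let $Z$ be a finite set. Suppose that for each $x \in Z$ there is given a subset $N_x \subset Z$ with $x \in N_x$, together with a weight $d_x(x,y) \in (0,\infty)$ for each $y \in N_x - \{x\}$. Let $(Z,D)$ be the ep-metric space obtained by amalgamating the ep-metric spaces $(Z,D_x)$, $x \in Z$, and let $R(N)$ be the ray complex of the weighted neighbourhoods $N = \{N_x\}$. Then the inclusion of filtered complexes $\phi : R(N) \subset V(Z,D)$ induces bijections $$\phi_\ast : \pi_0 R_s(N) \xrightarrow{\cong} \pi_0 V_s(Z,D)$$ for all real $s \geq 0$.
   Context: An ep-metric space (extended pseudo-metric space) $(X,d)$ is a set $X$ with a function $d : X\times X \to [0,\infty]$ such that $d(x,x)=0$, $d(x,y)=d(y,x)$ and $d(x,z) \leq d(x,y)+d(y,z)$. Distinct points may have distance $0$, and distances may be infinite. Morphisms are non-expanding functions; this category has all small colimits. A disjoint union has infinite distance between points of different summands. If $p: X \to Y$ is a surjective function and $(X,d)$ is an ep-metric space, the quotient ep-metric on $Y$ is $D(z,w) = \inf \sum_i d(x_i,y_i)$, the infimum being over finite sequences of pairs $(x_i,y_i)$, $0 \le i \leq n$, in $X$ with $p(x_0)=z$, $p(y_n)=w$, $p(y_i)=p(x_{i+1})$ (infimum of the empty set is $\infty$). For $y \in N_x-\{x\}$ the set $\{x,y\}$ is called a ray of $N_x$; it is an ep-metric space with distance $d_x(x,y)$ between $x$ and $y$. The weights of $N_x$ and $N_y$ are not required to be related: if also $x \in N_y$, then $d_y(y,x)$ may differ from $d_x(x,y)$. Let $Z_x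 = \bigvee_{y \in N_x-\{x\}} \{x,y\}$ be the wedge of the rays in ep-metric spaces (the quotient of the disjoint union of the rays which identifies all copies of $x$), with underlying set $N_x$. Let $(Z,D_x) = (\bigsqcup_{z \in Z-N_x} \{z\}) \sqcup Z_x$ (disjoint union of ep-metric spaces), an ep-metric on the set $Z$. Let $(Z,D) = \bigvee_{x \in Z} (Z,D_x)$ be the amalgamation along the set $Z$ in ep-metric spaces, i.e. the quotient of $\bigsqcup_{x\in Z} (Z,D_x)$ which identifies, for each $z \in Z$, all copies of $z$. For an ep-metric space $(X,D)$ and $s \geq 0$, $V_s(X,D)$ is the Vietoris-Rips complex: the abstract simplicial complex whose simplices are the non-empty finite subsets $\sigma \subset X$ with $D(u,v) \leq s$ for all $u,v \in \sigma$. The ray complex $R_s(N)$ is the graph (one-dimensional simplicial complex) with vertex set $Z$ and with an edge $\{x,y\}$ whenever $y \in N_x - \{x\}$ and $d_x(x,y) \leq s$ (for one of the two orderings of the pair); it is a subcomplex of $V_s(Z,D)$. $\pi_0$ denotes the set of path components. *)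

theory Defs
  imports "HOL-Analysis.Analysis"
begin

section \<open>Extended pseudo-metric spaces\<close>

type_synonym 'a ep_space = "'a set \<times> ('a \<Rightarrow> 'a \<Rightarrow> ennreal)"

definition ep_metric :: "'a ep_space \<Rightarrow> bool" where
  "ep_metric S \<longleftrightarrow>
     (\<forall>x\<in>fst S. snd S x x = 0) \<and>
     (\<forall>x\<in>fst S. \<forall>y\<in>fst S. snd S x y = snd S y x) \<and>
     (\<forall>x\<in>fst S. \<forall>y\<in>fst S. \<forall>z\<in>fst S. snd S x z \<le> snd S x y + snd S y z)"

definition ep_disjoint_union :: "'i set \<Rightarrow> ('i \<Rightarrow> 'a ep_space) \<Rightarrow> ('i \<times> 'a) ep_space" where
  "ep_disjoint_union I S =
     ((SIGMA i:I. fst (S i)),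
      (\<lambda>(i, u) (j, v). if i = j then snd (S i) u v else \<infinity>))"

text \<open>The sequences of pairs over which the quotient distance from \<open>z\<close> to \<open>w\<close> is an infimum.\<close>

definition ep_chains :: "('a \<Rightarrow> 'b) \<Rightarrow> 'a set \<Rightarrow> 'b \<Rightarrow> 'b \<Rightarrow> ('a \<times> 'a) list set" where
  "ep_chains p X z w =
     {c. c \<noteq> [] \<and> set c \<subseteq> X \<times> X \<and> p (fst (hd c)) = z \<and> p (snd (last c)) = w \<and>
         (\<forall>i. Suc i < length c \<longrightarrow> p (snd (c ! i)) = p (fst (c ! Suc i)))}"

definition ep_quotient :: "('a \<Rightarrow> 'b) \<Rightarrow> 'a ep_space \<Rightarrow> 'b ep_space" where
  "ep_quotient p S =
     (p ` fst S,
      (\<lambda>z w. INF c\<in>ep_chains p (fst S) z w. \<Sum>(x, y)\<leftarrow>c. snd S x y))"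

lemma ep_metric_disjoint_union:
  assumes "\<And>i. i \<in> I \<Longrightarrow> ep_metric (S i)"
  shows "ep_metric (ep_disjoint_union I S)"
  using assms by (fastforce simp: ep_metric_def ep_disjoint_union_def)

lemma ep_chains_append:
  assumes "c \<in> ep_chains p X u v" "e \<in> ep_chains p X v w"
  shows "c @ e \<in> ep_chains p X u w"
proof -
  have "p (snd ((c @ e) ! i)) = p (fst ((c @ e) ! Suc i))" if "Suc i < length (c @ e)" for i
  proof -
    consider "Suc i < length c" | "Suc i = length c" | "length c \<le> i" by linarith
    then show ?thesis
    proof cases
      case 1 then show ?thesis using assms by (auto simp: ep_chains_def nth_append)
    next
      case 2
      then have "c ! i = last c" "e ! 0 = hd e"
        using assms by (auto simp: ep_chains_def last_conv_nth hd_conv_nth simp flip: 2)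
      then show ?thesis using assms 2 by (auto simp: ep_chains_def nth_append)
    next
      case 3 then show ?thesis using assms that
        by (auto simp: ep_chains_def nth_append Suc_diff_le)
    qed
  qed
  then show ?thesis using assms by (auto simp: ep_chains_def)
qed

lemma ep_chains_rev:
  assumes "c \<in> ep_chains p X u v"
  shows "map prod.swap (rev c) \<in> ep_chains p X v u"
proof -
  have "p (snd (map prod.swap (rev c) ! i)) = p (fst (map prod.swap (rev c) ! Suc i))"
    if "Suc i < length c" for i
  proof -
    have "Suc (length c - Suc (Suc i)) = length c - Suc i" using that by simp
    moreover have "p (snd (c ! (length c - Suc (Suc i)))) =
        p (fst (c ! Suc (length c - Suc (Suc i))))"
      using assms that by (simp add: ep_chains_def)
    ultimately show ?thesis using that by (simp add: rev_nth)
  qed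
  then show ?thesis using assms
    by (auto simp: ep_chains_def hd_map last_map hd_rev last_rev)
qed

lemma ep_metric_quotient:
  assumes S: "ep_metric S"
  shows "ep_metric (ep_quotient p S)"
proof -
  obtain X d where Xd: "S = (X, d)" by (cases S)
  define len where "len c = (\<Sum>(x, y)\<leftarrow>c. d x y)" for c
  define D where "D = (\<lambda>z w. INF c\<in>ep_chains p X z w. len c)"
  have q: "ep_quotient p S = (p ` X, D)"
    by (simp add: ep_quotient_def Xd D_def len_def)
  have refl: "D (p x) (p x) = 0" if "x \<in> X" for x
  proof -
    have "[(x, x)] \<in> ep_chains p X (p x) (p x)" using that by (simp add: ep_chains_def)
    then have "D (p x) (p x) \<le> len [(x, x)]" unfolding D_def by (rule INF_lower)
    also have "\<dots> = 0" using S that by (simp add: len_def ep_metric_def Xd)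
    finally show ?thesis by simp
  qed
  have le: "D z w \<le> D w z" for z w
    unfolding D_def
  proof (rule INF_mono)
    fix c assume c: "c \<in> ep_chains p X w z"
    have "map (\<lambda>(x, y). d x y) (map prod.swap c) = map (\<lambda>(x, y). d x y) c"
      unfolding map_map using c S
      by (intro map_cong) (auto simp: ep_chains_def ep_metric_def Xd)
    then have "len (map prod.swap (rev c)) = len c"
      by (simp add: len_def sum_list_rev flip: rev_map del: map_map)
    then show "\<exists>e\<in>ep_chains p X z w. len e \<le> len c"
      using ep_chains_rev[OF c] by (metis order_refl)
  qed
  have tri: "D u w \<le> D u v + D v w" for u v w
  proof -
    have chain: "D u w \<le> len c + len e"
      if "c \<in> ep_chains p X u v" "e \<in> ep_chains p X v w" for c e
      using INF_lower[OF ep_chains_append[OF that], of len] by (simp add: D_def len_def)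
    show ?thesis
    proof (rule ennreal_le_epsilon)
      fix r :: real
      assume fin: "D u v + D v w < top" and r: "0 < r"
      have approx: "\<exists>c\<in>ep_chains p X a b. len c \<le> D a b + ennreal (r / 2)"
        if "D a b < top" for a b
      proof -
        have "D a b < D a b + ennreal (r / 2)"
          using that r by (cases "D a b") (auto simp flip: ennreal_plus simp: ennreal_less_iff)
        then show ?thesis
          unfolding D_def INF_less_iff by (auto intro: less_imp_le)
      qed
      obtain c e where "c \<in> ep_chains p X u v" "len c \<le> D u v + ennreal (r / 2)"
        "e \<in> ep_chains p X v w" "len e \<le> D v w + ennreal (r / 2)"
        using approx[of u v] approx[of v w] fin by auto
      then have "D u w \<le> (D u v + ennreal (r / 2)) + (D v w + ennreal (r / 2))"
        by (meson add_mono chain order_trans)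
      also have "\<dots> = D u v + D v w + (ennreal (r / 2) + ennreal (r / 2))"
        by (simp add: ac_simps)
      also have "ennreal (r / 2) + ennreal (r / 2) = ennreal r"
        using r by (simp flip: ennreal_plus)
      finally show "D u w \<le> D u v + D v w + ennreal r" .
    qed
  qed
  show ?thesis unfolding q ep_metric_def
    using refl le tri by (auto intro: antisym)
qed

section \<open>Amalgamation of weighted neighbourhoods\<close>

definition ray :: "('a \<Rightarrow> 'a \<Rightarrow> real) \<Rightarrow> 'a \<Rightarrow> 'a \<Rightarrow> 'a ep_space" where
  "ray d x y = ({x, y}, (\<lambda>u v. if u = v then 0 else ennreal (d x y)))"

text \<open>
  The wedge of the rays of \<open>N x\<close>, with underlying set \<open>N x\<close>.  If \<open>x\<close> has no rays this is the
  empty wedge, which is the one-point space on the base point and has to be treated separately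
  because the corresponding disjoint union is empty.
\<close>

definition ray_wedge :: "('a \<Rightarrow> 'a set) \<Rightarrow> ('a \<Rightarrow> 'a \<Rightarrow> real) \<Rightarrow> 'a \<Rightarrow> 'a ep_space" where
  "ray_wedge N d x =
     (if N x - {x} = {} then ({x}, \<lambda>u v. 0)
      else ep_quotient snd (ep_disjoint_union (N x - {x}) (ray d x)))"

text \<open>
  The disjoint union of \<open>ray_wedge N d x\<close> and the one-point spaces on the elements of \<open>Z - N x\<close>.
  The summands are already disjoint subsets of \<open>Z\<close>, so no tags are needed.
\<close>

definition neighbourhood_space ::
    "'a set \<Rightarrow> ('a \<Rightarrow> 'a set) \<Rightarrow> ('a \<Rightarrow> 'a \<Rightarrow> real) \<Rightarrow> 'a \<Rightarrow> 'a ep_space" where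
  "neighbourhood_space Z N d x =
     ((Z - N x) \<union> fst (ray_wedge N d x),
      (\<lambda>u v. if u \<in> N x \<and> v \<in> N x then snd (ray_wedge N d x) u v
             else if u = v then 0 else \<infinity>))"

definition amalgam ::
    "'a set \<Rightarrow> ('a \<Rightarrow> 'a set) \<Rightarrow> ('a \<Rightarrow> 'a \<Rightarrow> real) \<Rightarrow> 'a ep_space" where
  "amalgam Z N d = ep_quotient snd (ep_disjoint_union Z (neighbourhood_space Z N d))"

lemma carrier_ray_wedge:
  assumes "x \<in> N x"
  shows "fst (ray_wedge N d x) = N x"
proof (cases "N x - {x} = {}")
  case True
  then show ?thesis using assms by (auto simp: ray_wedge_def)
next
  case False
  have "snd ` (SIGMA y:N x - {x}. {x, y}) = N x"
  proof (intro equalityI subsetI)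
    fix u assume "u \<in> N x"
    then obtain y where "y \<in> N x - {x}" "u \<in> {x, y}" using False by blast
    then show "u \<in> snd ` (SIGMA y:N x - {x}. {x, y})" by force
  qed (use assms in auto)
  then show ?thesis
    using False by (simp add: ray_wedge_def ep_quotient_def ep_disjoint_union_def ray_def)
qed

lemma carrier_neighbourhood_space:
  "\<lbrakk>x \<in> N x; N x \<subseteq> Z\<rbrakk> \<Longrightarrow> fst (neighbourhood_space Z N d x) = Z"
  by (auto simp: neighbourhood_space_def carrier_ray_wedge)

lemma carrier_amalgam:
  "(\<And>x. x \<in> Z \<Longrightarrow> x \<in> N x \<and> N x \<subseteq> Z) \<Longrightarrow> fst (amalgam Z N d) = Z"
  by (force simp: amalgam_def ep_quotient_def ep_disjoint_union_def carrier_neighbourhood_space)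

lemma ep_metric_ray_wedge: "ep_metric (ray_wedge N d x)"
proof -
  have "ep_metric (ray d x y)" for y by (auto simp: ray_def ep_metric_def)
  then have "ep_metric (ep_quotient snd (ep_disjoint_union (N x - {x}) (ray d x)))"
    by (intro ep_metric_quotient ep_metric_disjoint_union)
  then show ?thesis by (simp add: ray_wedge_def ep_metric_def)
qed

lemma ep_metric_neighbourhood_space:
  assumes "x \<in> N x"
  shows "ep_metric (neighbourhood_space Z N d x)"
  using ep_metric_ray_wedge[of N d x] carrier_ray_wedge[of x N d, OF assms]
  by (auto simp: ep_metric_def neighbourhood_space_def)

lemma ep_metric_amalgam:
  "(\<And>x. x \<in> Z \<Longrightarrow> x \<in> N x) \<Longrightarrow> ep_metric (amalgam Z N d)"
  unfolding amalgam_def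
  by (intro ep_metric_quotient ep_metric_disjoint_union ep_metric_neighbourhood_space)

section \<open>Simplicial complexes\<close>

text \<open>An abstract simplicial complex is represented by its set of (non-empty, finite) simplices.\<close>

definition vietoris_rips :: "'a ep_space \<Rightarrow> real \<Rightarrow> 'a set set" where
  "vietoris_rips S s =
     {\<sigma>. \<sigma> \<noteq> {} \<and> finite \<sigma> \<and> \<sigma> \<subseteq> fst S \<and> (\<forall>u\<in>\<sigma>. \<forall>v\<in>\<sigma>. snd S u v \<le> ennreal s)}"

definition ray_complex ::
    "'a set \<Rightarrow> ('a \<Rightarrow> 'a set) \<Rightarrow> ('a \<Rightarrow> 'a \<Rightarrow> real) \<Rightarrow> real \<Rightarrow> 'a set set" where
  "ray_complex Z N d s =
     {{x} | x. x \<in> Z} \<union> {{x, y} | x y. x \<in> Z \<and> y \<in> N x - {x} \<and> d x y \<le> s}"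

text \<open>
  Points of the geometric realization are given by their barycentric coordinates; a set is open
  if its trace on every closed simplex is open.
\<close>

definition geometric_simplex :: "'a set \<Rightarrow> ('a \<Rightarrow> real) set" where
  "geometric_simplex \<sigma> =
     {t. (\<forall>v. 0 \<le> t v) \<and> (\<forall>v. v \<notin> \<sigma> \<longrightarrow> t v = 0) \<and> (\<Sum>v\<in>\<sigma>. t v) = 1}"

definition realization :: "'a set set \<Rightarrow> ('a \<Rightarrow> real) topology" where
  "realization K =
     topology (\<lambda>U. U \<subseteq> (\<Union>\<sigma>\<in>K. geometric_simplex \<sigma>) \<and>
       (\<forall>\<sigma>\<in>K. openin (top_of_set (geometric_simplex \<sigma>)) (U \<inter> geometric_simplex \<sigma>)))"

lemma openin_realization:
  "openin (realization K) U \<longleftrightarrow>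
     U \<subseteq> (\<Union>\<sigma>\<in>K. geometric_simplex \<sigma>) \<and>
     (\<forall>\<sigma>\<in>K. openin (top_of_set (geometric_simplex \<sigma>)) (U \<inter> geometric_simplex \<sigma>))"
proof -
  have "istopology (\<lambda>U. U \<subseteq> (\<Union>\<sigma>\<in>K. geometric_simplex \<sigma>) \<and>
     (\<forall>\<sigma>\<in>K. openin (top_of_set (geometric_simplex \<sigma>)) (U \<inter> geometric_simplex \<sigma>)))"
    unfolding istopology_def
  proof (intro conjI allI impI ballI)
    fix S T \<sigma>
    assume "S \<subseteq> (\<Union>\<sigma>\<in>K. geometric_simplex \<sigma>) \<and>
        (\<forall>\<sigma>\<in>K. openin (top_of_set (geometric_simplex \<sigma>)) (S \<inter> geometric_simplex \<sigma>))"
      "T \<subseteq> (\<Union>\<sigma>\<in>K. geometric_simplex \<sigma>) \<and>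
        (\<forall>\<sigma>\<in>K. openin (top_of_set (geometric_simplex \<sigma>)) (T \<inter> geometric_simplex \<sigma>))"
      "\<sigma> \<in> K"
    then have "openin (top_of_set (geometric_simplex \<sigma>))
        ((S \<inter> geometric_simplex \<sigma>) \<inter> (T \<inter> geometric_simplex \<sigma>))"
      by (blast intro: openin_Int)
    then show "openin (top_of_set (geometric_simplex \<sigma>)) (S \<inter> T \<inter> geometric_simplex \<sigma>)"
      by (simp add: Int_ac)
  next
    fix \<U> \<sigma>
    assume "\<forall>S\<in>\<U>. S \<subseteq> (\<Union>\<sigma>\<in>K. geometric_simplex \<sigma>) \<and>
        (\<forall>\<sigma>\<in>K. openin (top_of_set (geometric_simplex \<sigma>)) (S \<inter> geometric_simplex \<sigma>))"
      "\<sigma> \<in> K"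
    then have "openin (top_of_set (geometric_simplex \<sigma>)) (\<Union>S\<in>\<U>. S \<inter> geometric_simplex \<sigma>)"
      by (intro openin_Union) auto
    then show "openin (top_of_set (geometric_simplex \<sigma>)) (\<Union>\<U> \<inter> geometric_simplex \<sigma>)"
      by simp
  qed blast+
  then show ?thesis by (simp add: realization_def topology_inverse')
qed

definition pi0 :: "'a set set \<Rightarrow> ('a \<Rightarrow> real) set set" where
  "pi0 K = path_components_of (realization K)"

text \<open>
  The map induced on path components by the inclusion of a subcomplex into \<open>L\<close>; the realization
  of that inclusion is itself an inclusion, so \<open>C\<close> is sent to the component of \<open>L\<close> containing it.
\<close>

definition pi0_inclusion :: "'a set set \<Rightarrow> ('a \<Rightarrow> real) set \<Rightarrow> ('a \<Rightarrow> real) set" where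
  "pi0_inclusion L C = (THE C'. C' \<in> pi0 L \<and> C \<subseteq> C')"

end

theory Submission
  imports Defs
begin

text \<open>
  Path components of a simplicial complex only depend on its vertices and on which of them span
  simplices: two points of the realization lie in the same component iff vertices of simplices
  containing them are linked by a chain of simplices (\<open>pi0_vertex_classes\<close>).  So an inclusion
  of complexes with the same vertices is a bijection on \<open>\<pi>\<^sub>0\<close> as soon as any two vertices of a
  simplex of the larger complex are already linked in the smaller one (\<open>bij_betw_pi0_inclusion\<close>).

  It remains to see that \<open>D u v \<le> s\<close> forces \<open>u\<close> and \<open>v\<close> to be linked by rays of length at
  most \<open>s\<close>.  As there are finitely many rays, some \<open>t > s\<close> is a lower bound for the lengths of
  all rays longer than \<open>s\<close>, and then any two unlinked ends of a ray have distance at least \<open>t\<close>.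
  This lower bound for the distance of unlinked points survives disjoint unions, where new
  distances are infinite, and quotients: since linking is transitive, a chain between unlinked
  points has a step between unlinked points, and that step alone costs at least \<open>t\<close>
  (\<open>separates_quotient\<close>).  The space \<open>(Z, D)\<close> is built from rays by these operations, so unlinked
  points of \<open>Z\<close> have distance at least \<open>t > s\<close>.  The gap between \<open>s\<close> and \<open>t\<close> is what makes
  the argument work for infima that need not be attained.
\<close>

section \<open>Path components of the realization of a complex\<close>

definition linked :: "'a set set \<Rightarrow> 'a \<Rightarrow> 'a \<Rightarrow> bool" where
  "linked K = (\<lambda>u v. \<exists>\<sigma>\<in>K. u \<in> \<sigma> \<and> v \<in> \<sigma>)\<^sup>*\<^sup>*"

lemma linked_simplex: "\<lbrakk>\<sigma> \<in> K; u \<in> \<sigma>; v \<in> \<sigma>\<rbrakk> \<Longrightarrow> linked K u v"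
  unfolding linked_def by (rule r_into_rtranclp) blast

lemma linked_refl [simp]: "linked K u u"
  by (simp add: linked_def)

lemma linked_trans: "\<lbrakk>linked K u v; linked K v w\<rbrakk> \<Longrightarrow> linked K u w"
  unfolding linked_def by (rule rtranclp_trans)

lemma linked_sym: "linked K u v \<Longrightarrow> linked K v u"
  unfolding linked_def
  by (rule sympD[OF symp_rtranclp]) (auto intro: sympI)

lemma linked_least:
  assumes "\<And>\<sigma> u v. \<lbrakk>\<sigma> \<in> L; u \<in> \<sigma>; v \<in> \<sigma>\<rbrakk> \<Longrightarrow> linked K u v" and "linked L u v"
  shows "linked K u v"
  using assms(2) unfolding linked_def[of L]
  by (induction rule: rtranclp_induct) (use assms(1) linked_trans in fastforce)+

definition vertex_class :: "'a set set \<Rightarrow> 'a \<Rightarrow> ('a \<Rightarrow> real) set" where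
  "vertex_class K u = (\<Union>\<sigma>\<in>{\<sigma> \<in> K. \<exists>v\<in>\<sigma>. linked K u v}. geometric_simplex \<sigma>)"

definition vertex_point :: "'a \<Rightarrow> 'a \<Rightarrow> real" where
  "vertex_point v = (\<lambda>w. if w = v then 1 else 0)"

lemma vertex_point_simplex_iff:
  "finite \<sigma> \<Longrightarrow> vertex_point v \<in> geometric_simplex \<sigma> \<longleftrightarrow> v \<in> \<sigma>"
  by (auto simp: vertex_point_def geometric_simplex_def)

lemma geometric_simplex_obtain_vertex:
  assumes "a \<in> geometric_simplex \<sigma>"
  obtains v where "v \<in> \<sigma>" "0 < a v"
proof -
  have "(\<Sum>v\<in>\<sigma>. a v) \<noteq> 0" using assms by (simp add: geometric_simplex_def)
  then have "\<exists>v\<in>\<sigma>. a v \<noteq> 0" by (meson sum.neutral)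
  then show ?thesis
    using assms that by (force simp: geometric_simplex_def less_le)
qed

text \<open>
  Two simplices with a common point share a vertex, because the point has a positive coordinate.
  Hence distinct vertex classes do not meet.
\<close>

lemma linked_if_in_vertex_class:
  assumes "a \<in> vertex_class K u" "a \<in> geometric_simplex \<sigma>" "\<sigma> \<in> K" "w \<in> \<sigma>"
  shows "linked K u w"
proof -
  obtain \<tau> v where \<tau>: "\<tau> \<in> K" "v \<in> \<tau>" "linked K u v" "a \<in> geometric_simplex \<tau>"
    using assms(1) by (auto simp: vertex_class_def)
  obtain x where "x \<in> \<tau>" "0 < a x"
    using geometric_simplex_obtain_vertex[OF \<tau>(4)] .
  moreover from \<open>0 < a x\<close> have "x \<in> \<sigma>"
    using assms(2) by (auto simp: geometric_simplex_def)
  ultimately show ?thesis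
    using \<tau> assms(3,4) by (meson linked_simplex linked_trans)
qed

lemma vertex_class_cong:
  assumes "linked K u v"
  shows "vertex_class K u = vertex_class K v"
proof -
  have "linked K u w \<longleftrightarrow> linked K v w" for w
    using assms linked_sym linked_trans by metis
  then show ?thesis by (simp add: vertex_class_def)
qed

lemma linked_iff_vertex_point_in_class:
  assumes "\<And>\<sigma>. \<sigma> \<in> K \<Longrightarrow> finite \<sigma>" "v \<in> \<Union>K"
  shows "vertex_point v \<in> vertex_class K u \<longleftrightarrow> linked K u v"
proof
  obtain \<sigma> where \<sigma>: "\<sigma> \<in> K" "v \<in> \<sigma>" using assms(2) by blast
  then have p: "vertex_point v \<in> geometric_simplex \<sigma>"
    using assms(1) by (simp add: vertex_point_simplex_iff)
  show "linked K u v" if "vertex_point v \<in> vertex_class K u"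
    using linked_if_in_vertex_class[OF that p \<sigma>] .
  show "vertex_point v \<in> vertex_class K u" if "linked K u v"
    using that \<sigma> p by (auto simp: vertex_class_def)
qed

lemma topspace_realization: "topspace (realization K) = (\<Union>\<sigma>\<in>K. geometric_simplex \<sigma>)"
proof (rule antisym)
  show "topspace (realization K) \<subseteq> (\<Union>\<sigma>\<in>K. geometric_simplex \<sigma>)"
    using openin_topspace[of "realization K"] unfolding openin_realization by blast
  have "openin (realization K) (\<Union>\<sigma>\<in>K. geometric_simplex \<sigma>)"
    unfolding openin_realization by (auto simp: Int_absorb1 UN_upper)
  then show "(\<Union>\<sigma>\<in>K. geometric_simplex \<sigma>) \<subseteq> topspace (realization K)"
    by (rule openin_subset)
qed

text \<open>
  The topology is coherent with the simplices, so only traces on simplices matter, and here every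
  trace is empty or the whole simplex.  The hypothesis is symmetric under taking complements, which
  is how vertex classes turn out to be clopen.
\<close>

lemma openin_realization_simplexwise:
  assumes "U \<subseteq> topspace (realization K)"
    and "\<And>\<sigma>. \<sigma> \<in> K \<Longrightarrow> geometric_simplex \<sigma> \<subseteq> U \<or> geometric_simplex \<sigma> \<inter> U = {}"
  shows "openin (realization K) U"
  unfolding openin_realization
proof (intro conjI ballI)
  show "U \<subseteq> (\<Union>\<sigma>\<in>K. geometric_simplex \<sigma>)" using assms(1) by (simp add: topspace_realization)
  fix \<sigma> assume "\<sigma> \<in> K"
  then have "U \<inter> geometric_simplex \<sigma> = geometric_simplex \<sigma> \<or> U \<inter> geometric_simplex \<sigma> = {}"
    using assms(2) by blast
  then show "openin (top_of_set (geometric_simplex \<sigma>)) (U \<inter> geometric_simplex \<sigma>)"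
    by auto
qed

lemma vertex_class_clopen:
  "openin (realization K) (vertex_class K u)"
  "closedin (realization K) (vertex_class K u)"
proof -
  have sub: "vertex_class K u \<subseteq> topspace (realization K)"
    by (auto simp: topspace_realization vertex_class_def)
  have dich: "geometric_simplex \<sigma> \<subseteq> vertex_class K u \<or> geometric_simplex \<sigma> \<inter> vertex_class K u = {}"
    if \<sigma>: "\<sigma> \<in> K" for \<sigma>
  proof (rule disjCI)
    assume "geometric_simplex \<sigma> \<inter> vertex_class K u \<noteq> {}"
    then obtain a where a: "a \<in> geometric_simplex \<sigma>" "a \<in> vertex_class K u" by blast
    obtain w where "w \<in> \<sigma>" using geometric_simplex_obtain_vertex[OF a(1)] .
    then show "geometric_simplex \<sigma> \<subseteq> vertex_class K u"
      using linked_if_in_vertex_class[OF a(2,1) \<sigma>] \<sigma> by (auto simp: vertex_class_def)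
  qed
  show "openin (realization K) (vertex_class K u)"
    using sub dich by (rule openin_realization_simplexwise)
  have "openin (realization K) (topspace (realization K) - vertex_class K u)"
  proof (rule openin_realization_simplexwise)
    show "geometric_simplex \<sigma> \<subseteq> topspace (realization K) - vertex_class K u \<or>
        geometric_simplex \<sigma> \<inter> (topspace (realization K) - vertex_class K u) = {}"
      if "\<sigma> \<in> K" for \<sigma>
      using dich[OF that] that by (auto simp: topspace_realization)
  qed blast
  then show "closedin (realization K) (vertex_class K u)"
    using sub by (simp add: closedin_def)
qed

lemma path_component_of_simplex:
  assumes "\<sigma> \<in> K" "a \<in> geometric_simplex \<sigma>" "b \<in> geometric_simplex \<sigma>"
  shows "path_component_of (realization K) a b"
proof -
  define g where "g = (\<lambda>r v. (1 - r) * a v + r * b v :: real)"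
  have "continuous_on {0..1} g"
    unfolding g_def by (intro continuous_on_coordinatewise_then_product continuous_intros)
  moreover have "g r \<in> geometric_simplex \<sigma>" if "r \<in> {0..1}" for r
    using assms(2,3) that
    by (auto simp: geometric_simplex_def g_def sum.distrib simp flip: sum_distrib_left)
  ultimately have "continuous_map (top_of_set {0..1}) (top_of_set (geometric_simplex \<sigma>)) g"
    by auto
  moreover have "continuous_map (top_of_set (geometric_simplex \<sigma>)) (realization K) id"
    unfolding continuous_map_def
  proof (intro conjI allI impI)
    show "id \<in> topspace (top_of_set (geometric_simplex \<sigma>)) \<rightarrow> topspace (realization K)"
      using assms(1) by (auto simp: topspace_realization)
    fix U assume "openin (realization K) U"
    then have "openin (top_of_set (geometric_simplex \<sigma>)) (U \<inter> geometric_simplex \<sigma>)"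
      using assms(1) by (simp add: openin_realization)
    moreover have "{x \<in> topspace (top_of_set (geometric_simplex \<sigma>)). id x \<in> U} =
        U \<inter> geometric_simplex \<sigma>" by auto
    ultimately show "openin (top_of_set (geometric_simplex \<sigma>))
        {x \<in> topspace (top_of_set (geometric_simplex \<sigma>)). id x \<in> U}" by simp
  qed
  ultimately have "continuous_map (top_of_set {0..1}) (realization K) (id \<circ> g)"
    by (rule continuous_map_compose)
  then have "pathin (realization K) g" by (simp add: pathin_def)
  moreover have "g 0 = a" "g 1 = b" by (auto simp: g_def)
  ultimately show ?thesis unfolding path_component_of_def by blast
qed

lemma path_component_of_linked:
  assumes "\<And>\<sigma>. \<sigma> \<in> K \<Longrightarrow> finite \<sigma>" and "u \<in> \<Union>K" and "linked K u v"
  shows "path_component_of (realization K) (vertex_point u) (vertex_point v)"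
  using assms(3) unfolding linked_def
proof (induction rule: rtranclp_induct)
  case base
  obtain \<sigma> where "\<sigma> \<in> K" "u \<in> \<sigma>" using assms(2) by blast
  then show ?case
    using assms(1) by (auto intro!: path_component_of_simplex simp: vertex_point_simplex_iff)
next
  case (step v w)
  then obtain \<sigma> where "\<sigma> \<in> K" "v \<in> \<sigma>" "w \<in> \<sigma>" by blast
  then have "path_component_of (realization K) (vertex_point v) (vertex_point w)"
    using assms(1) by (auto intro!: path_component_of_simplex simp: vertex_point_simplex_iff)
  then show ?case using step.IH path_component_of_trans by metis
qed

text \<open>
  Each point of a vertex class is joined by a segment to a vertex, and linked vertices are joined by
  paths of segments, so a vertex class is path connected; being clopen, it is not contained in a
  larger component.
\<close>

lemma path_component_of_set_vertex_point:
  assumes fin: "\<And>\<sigma>. \<sigma> \<in> K \<Longrightarrow> finite \<sigma>" and u: "u \<in> \<Union>K"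
  shows "Collect (path_component_of (realization K) (vertex_point u)) = vertex_class K u"
proof (rule antisym)
  have "vertex_point u \<in> vertex_class K u"
    using linked_iff_vertex_point_in_class[OF fin u] by simp
  moreover have "vertex_point u \<in> Collect (path_component_of (realization K) (vertex_point u))"
    using path_component_of_linked[OF fin u linked_refl] by simp
  moreover have "connectedin (realization K)
      (Collect (path_component_of (realization K) (vertex_point u)))"
    by (simp add: path_connectedin_imp_connectedin path_connectedin_path_component_of)
  ultimately show "Collect (path_component_of (realization K) (vertex_point u)) \<subseteq> vertex_class K u"
    using connectedin_clopen_cases[OF _ vertex_class_clopen(2,1)] by (fastforce simp: disjnt_iff)
next
  show "vertex_class K u \<subseteq> Collect (path_component_of (realization K) (vertex_point u))"
  proof
    fix a assume "a \<in> vertex_class K u"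
    then obtain \<sigma> v where \<sigma>: "\<sigma> \<in> K" "v \<in> \<sigma>" "linked K u v" "a \<in> geometric_simplex \<sigma>"
      by (auto simp: vertex_class_def)
    then have "path_component_of (realization K) (vertex_point v) a"
      using fin by (auto intro!: path_component_of_simplex simp: vertex_point_simplex_iff)
    then show "a \<in> Collect (path_component_of (realization K) (vertex_point u))"
      using path_component_of_linked[OF fin u \<sigma>(3)] path_component_of_trans by fastforce
  qed
qed

lemma pi0_vertex_classes:
  assumes fin: "\<And>\<sigma>. \<sigma> \<in> K \<Longrightarrow> finite \<sigma>"
  shows "pi0 K = vertex_class K ` \<Union>K"
proof (rule antisym)
  show "pi0 K \<subseteq> vertex_class K ` \<Union>K"
  proof
    fix C assume "C \<in> pi0 K"
    then obtain a \<sigma> where a: "\<sigma> \<in> K" "a \<in> geometric_simplex \<sigma>"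
      and C: "C = Collect (path_component_of (realization K) a)"
      by (auto simp: pi0_def path_components_of_def topspace_realization)
    obtain v where v: "v \<in> \<sigma>" using geometric_simplex_obtain_vertex[OF a(2)] .
    then have "path_component_of (realization K) a (vertex_point v)"
      using a fin by (auto intro!: path_component_of_simplex simp: vertex_point_simplex_iff)
    then have "C = Collect (path_component_of (realization K) (vertex_point v))"
      unfolding C by (metis path_component_of_equiv)
    also have "\<dots> = vertex_class K v"
      using a(1) v by (intro path_component_of_set_vertex_point fin) auto
    finally show "C \<in> vertex_class K ` \<Union>K" using a(1) v by blast
  qed
next
  show "vertex_class K ` \<Union>K \<subseteq> pi0 K"
  proof
    fix C assume "C \<in> vertex_class K ` \<Union>K"
    then obtain u where u: "u \<in> \<Union>K" and C: "C = vertex_class K u" by blast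
    have "vertex_point u \<in> topspace (realization K)"
      using u fin by (auto simp: topspace_realization vertex_point_simplex_iff)
    moreover have "C = Collect (path_component_of (realization K) (vertex_point u))"
      unfolding C using path_component_of_set_vertex_point[OF fin u] by simp
    ultimately show "C \<in> pi0 K"
      by (auto simp: pi0_def path_components_of_def)
  qed
qed

text \<open>
  Both sets of components are indexed by the same vertices, modulo the same linking relation; the
  induced map sends the class of a vertex to the class of that vertex.
\<close>

lemma bij_betw_pi0_inclusion:
  assumes sub: "K \<subseteq> L" and vert: "\<Union>L \<subseteq> \<Union>K" and fin: "\<And>\<sigma>. \<sigma> \<in> L \<Longrightarrow> finite \<sigma>"
    and linked: "\<And>\<sigma> u v. \<lbrakk>\<sigma> \<in> L; u \<in> \<sigma>; v \<in> \<sigma>\<rbrakk> \<Longrightarrow> linked K u v"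
  shows "bij_betw (pi0_inclusion L) (pi0 K) (pi0 L)"
proof -
  have V: "\<Union>K = \<Union>L" using sub vert by blast
  have finK: "\<And>\<sigma>. \<sigma> \<in> K \<Longrightarrow> finite \<sigma>" using sub fin by blast
  have LK: "linked K u v" if "linked L u v" for u v
    using linked that by (rule linked_least)
  have KL: "linked L u v" if "linked K u v" for u v
    using linked_simplex[OF subsetD[OF sub]] that by (rule linked_least)
  have pi0: "pi0 K = vertex_class K ` \<Union>K" "pi0 L = vertex_class L ` \<Union>L"
    by (rule pi0_vertex_classes, rule finK, assumption)
       (rule pi0_vertex_classes, rule fin, assumption)
  have iffK: "vertex_point v \<in> vertex_class K u \<longleftrightarrow> linked K u v" if "v \<in> \<Union>K" for u v
    using that by (intro linked_iff_vertex_point_in_class finK)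
  have iffL: "vertex_point v \<in> vertex_class L u \<longleftrightarrow> linked L u v" if "v \<in> \<Union>L" for u v
    using that by (intro linked_iff_vertex_point_in_class fin)
  have inclusion: "pi0_inclusion L (vertex_class K v) = vertex_class L v" if v: "v \<in> \<Union>L" for v
    unfolding pi0_inclusion_def
  proof (rule the_equality)
    have "vertex_class K v \<subseteq> vertex_class L v"
      unfolding vertex_class_def using sub KL by (intro UN_mono) blast+
    then show "vertex_class L v \<in> pi0 L \<and> vertex_class K v \<subseteq> vertex_class L v"
      unfolding pi0 using v by blast
    fix C assume C: "C \<in> pi0 L \<and> vertex_class K v \<subseteq> C"
    then obtain w where w: "C = vertex_class L w" unfolding pi0 by blast
    have "vertex_point v \<in> vertex_class K v"
      using iffK v V by simp
    then have "vertex_point v \<in> vertex_class L w" using C w by blast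
    then have "linked L w v" using iffL[OF v] by simp
    then show "C = vertex_class L v" unfolding w by (rule vertex_class_cong)
  qed
  show ?thesis unfolding bij_betw_def
  proof
    show "inj_on (pi0_inclusion L) (pi0 K)"
    proof (rule inj_onI)
      fix A B assume "A \<in> pi0 K" "B \<in> pi0 K" and eq: "pi0_inclusion L A = pi0_inclusion L B"
      then obtain u v where uv: "u \<in> \<Union>L" "v \<in> \<Union>L" "A = vertex_class K u" "B = vertex_class K v"
        unfolding pi0 V by blast
      then have "vertex_class L u = vertex_class L v" using eq inclusion by simp
      then have "linked L u v"
        using iffL[OF uv(2)] linked_refl by metis
      then show "A = B" unfolding uv by (intro vertex_class_cong LK)
    qed
    show "pi0_inclusion L ` pi0 K = pi0 L"
      unfolding pi0 V using inclusion by (simp add: image_image)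
  qed
qed

section \<open>Lower bounds for the distance of unrelated points\<close>

definition separates :: "('a \<Rightarrow> 'a \<Rightarrow> bool) \<Rightarrow> ennreal \<Rightarrow> 'a ep_space \<Rightarrow> bool" where
  "separates E t S \<longleftrightarrow> (\<forall>u\<in>fst S. \<forall>v\<in>fst S. E u v \<or> t \<le> snd S u v)"

lemma separates_disjoint_union:
  assumes "\<And>i. i \<in> I \<Longrightarrow> separates E t (S i)"
  shows "separates (\<lambda>u v. E (snd u) (snd v)) t (ep_disjoint_union I S)"
  using assms by (auto simp: separates_def ep_disjoint_union_def)

lemma ep_chains_related:
  assumes "reflp E" "transp E" "c \<in> ep_chains p X z w"
    and "\<And>x y. (x, y) \<in> set c \<Longrightarrow> E (p x) (p y)"
  shows "E z w"
  using assms(3,4)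
proof (induction c arbitrary: z)
  case Nil
  then show ?case by (simp add: ep_chains_def)
next
  case (Cons a c)
  have a: "E z (p (snd a))"
    using Cons.prems by (cases a) (auto simp: ep_chains_def)
  show ?case
  proof (cases "c = []")
    case True
    then show ?thesis using a Cons.prems(1) by (simp add: ep_chains_def)
  next
    case False
    have "p (snd ((a # c) ! i)) = p (fst ((a # c) ! Suc i))" if "i < length c" for i
      using Cons.prems(1) that by (simp add: ep_chains_def)
    then have "p (snd a) = p (fst (hd c))"
      "\<And>i. Suc i < length c \<Longrightarrow> p (snd (c ! i)) = p (fst (c ! Suc i))"
      using False by (fastforce simp: hd_conv_nth)+
    then have "c \<in> ep_chains p X (p (snd a)) w"
      using Cons.prems(1) False by (auto simp: ep_chains_def)
    then have "E (p (snd a)) w" using Cons.IH Cons.prems(2) by simp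
    then show ?thesis using a assms(2) by (meson transpD)
  qed
qed

text \<open>
  By transitivity a chain between unrelated points has a step between unrelated points, and the
  length of that step bounds the length of the chain from below.
\<close>

lemma separates_quotient:
  assumes E: "reflp E" "transp E" and S: "separates (\<lambda>u v. E (p u) (p v)) t S"
  shows "separates E t (ep_quotient p S)"
proof -
  have "t \<le> (\<Sum>(x, y)\<leftarrow>c. snd S x y)" if zw: "\<not> E z w" and c: "c \<in> ep_chains p (fst S) z w" for z w c
  proof -
    obtain x y where xy: "(x, y) \<in> set c" "\<not> E (p x) (p y)"
      using ep_chains_related[OF E c] zw by blast
    then have "x \<in> fst S" "y \<in> fst S" using c by (auto simp: ep_chains_def)
    then have "t \<le> snd S x y" using S xy(2) by (auto simp: separates_def)
    also have "\<dots> \<le> (\<Sum>(x, y)\<leftarrow>c. snd S x y)"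
      using xy(1) by (intro member_le_sum_list) (force, simp)
    finally show ?thesis .
  qed
  then show ?thesis by (auto simp: separates_def ep_quotient_def intro!: INF_greatest)
qed

lemma ep_quotient_le:
  assumes "x \<in> fst S" "y \<in> fst S"
  shows "snd (ep_quotient p S) (p x) (p y) \<le> snd S x y"
proof -
  have "[(x, y)] \<in> ep_chains p (fst S) (p x) (p y)" using assms by (simp add: ep_chains_def)
  then show ?thesis by (auto simp: ep_quotient_def intro: INF_lower2)
qed

section \<open>The amalgamation of weighted neighbourhoods\<close>

lemma separates_amalgam:
  assumes N: "\<And>x. x \<in> Z \<Longrightarrow> x \<in> N x"
    and E: "reflp E" "transp E" "symp E"
    and rays: "\<And>x y. \<lbrakk>x \<in> Z; y \<in> N x - {x}\<rbrakk> \<Longrightarrow> E x y \<or> t \<le> ennreal (d x y)"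
  shows "separates E t (amalgam Z N d)"
proof -
  have ray: "separates E t (ray d x y)" if "x \<in> Z" "y \<in> N x - {x}" for x y
    using rays[OF that] E(1,3) by (auto simp: separates_def ray_def reflp_def dest: sympD)
  have wedge: "separates E t (ray_wedge N d x)" if x: "x \<in> Z" for x
  proof (cases "N x - {x} = {}")
    case True
    then show ?thesis using E(1) by (simp add: ray_wedge_def separates_def reflp_def)
  next
    case False
    then show ?thesis
      unfolding ray_wedge_def using ray[OF x]
      by (auto intro!: separates_quotient separates_disjoint_union E(1,2))
  qed
  have "separates E t (neighbourhood_space Z N d x)" if x: "x \<in> Z" for x
    using wedge[OF x] E(1) N[OF x]
    by (auto simp: separates_def neighbourhood_space_def carrier_ray_wedge reflp_def)
  then show ?thesis
    unfolding amalgam_def by (intro separates_quotient separates_disjoint_union E(1,2))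
qed

text \<open>
  Quotient maps and inclusions of summands are non-expanding, so the ray from \<open>x\<close> to \<open>y\<close> maps
  through its wedge into the amalgamation without growing.
\<close>

lemma amalgam_le_weight:
  assumes N: "\<And>x. x \<in> Z \<Longrightarrow> x \<in> N x \<and> N x \<subseteq> Z" and x: "x \<in> Z" and y: "y \<in> N x - {x}"
  shows "snd (amalgam Z N d) x y \<le> ennreal (d x y)"
proof -
  let ?W = "ep_disjoint_union (N x - {x}) (ray d x)"
  let ?U = "ep_disjoint_union Z (neighbourhood_space Z N d)"
  have "fst (neighbourhood_space Z N d x) = Z"
    using N x by (intro carrier_neighbourhood_space) auto
  then have "(x, x) \<in> fst ?U" "(x, y) \<in> fst ?U"
    using N[OF x] x y by (auto simp: ep_disjoint_union_def)
  then have "snd (amalgam Z N d) x y \<le> snd ?U (x, x) (x, y)"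
    unfolding amalgam_def using ep_quotient_le[of _ ?U _ snd] by fastforce
  also have "\<dots> = snd (ray_wedge N d x) x y"
    using N[OF x] y by (simp add: ep_disjoint_union_def neighbourhood_space_def)
  also have "\<dots> = snd (ep_quotient snd ?W) (snd (y, x)) (snd (y, y))"
    using y by (auto simp: ray_wedge_def)
  also have "\<dots> \<le> snd ?W (y, x) (y, y)"
    using y by (intro ep_quotient_le) (auto simp: ep_disjoint_union_def ray_def)
  also have "\<dots> = ennreal (d x y)" using y by (auto simp: ep_disjoint_union_def ray_def)
  finally show ?thesis .
qed

lemma ray_complex_subset_vietoris_rips:
  assumes N: "\<And>x. x \<in> Z \<Longrightarrow> x \<in> N x \<and> N x \<subseteq> Z"
  shows "ray_complex Z N d s \<subseteq> vietoris_rips (amalgam Z N d) s"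
proof
  have car: "fst (amalgam Z N d) = Z" using N by (rule carrier_amalgam)
  have "ep_metric (amalgam Z N d)" using N by (intro ep_metric_amalgam) blast
  then have refl: "\<And>x. x \<in> Z \<Longrightarrow> snd (amalgam Z N d) x x = 0"
    and sym: "\<And>x y. \<lbrakk>x \<in> Z; y \<in> Z\<rbrakk> \<Longrightarrow> snd (amalgam Z N d) x y = snd (amalgam Z N d) y x"
    by (auto simp: ep_metric_def car)
  fix \<sigma> assume "\<sigma> \<in> ray_complex Z N d s"
  then consider x where "\<sigma> = {x}" "x \<in> Z"
    | x y where "\<sigma> = {x, y}" "x \<in> Z" "y \<in> N x - {x}" "d x y \<le> s"
    by (auto simp: ray_complex_def)
  then show "\<sigma> \<in> vietoris_rips (amalgam Z N d) s"
  proof cases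
    case 1
    then show ?thesis by (simp add: vietoris_rips_def car refl)
  next
    case 2
    have "snd (amalgam Z N d) x y \<le> ennreal s"
      using amalgam_le_weight[OF N 2(2,3)] 2(4) by (meson ennreal_leI order_trans)
    moreover have "y \<in> Z" using N 2 by blast
    ultimately show ?thesis using 2(1,2) sym[of x y] by (auto simp: vietoris_rips_def car refl)
  qed
qed

text \<open>
  Closeness in the amalgamation is a statement about an infimum of chains; the threshold \<open>t\<close>,
  strictly above \<open>s\<close>, avoids having to find a chain that attains it.
\<close>

lemma linked_ray_complex_if_amalgam_le:
  assumes fin: "finite Z" and N: "\<And>x. x \<in> Z \<Longrightarrow> x \<in> N x \<and> N x \<subseteq> Z" and s: "0 \<le> s"
    and uv: "u \<in> Z" "v \<in> Z" and le: "snd (amalgam Z N d) u v \<le> ennreal s"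
  shows "linked (ray_complex Z N d s) u v"
proof (rule ccontr)
  let ?E = "linked (ray_complex Z N d s)"
  define W where "W = {ennreal (d x y) | x y. x \<in> Z \<and> y \<in> N x - {x} \<and> s < d x y}"
  have "finite ((\<lambda>(x, y). ennreal (d x y)) ` (Z \<times> Z))" using fin by simp
  then have W: "finite W" by (rule rev_finite_subset) (use N in \<open>force simp: W_def\<close>)
  \<comment> \<open>The threshold is infinite when no ray is longer than \<open>s\<close>.\<close>
  define t where "t = Min (insert \<infinity> W)"
  have "ennreal s < t"
    unfolding t_def using W s by (auto simp: W_def ennreal_less_iff)
  have rays: "?E x y \<or> t \<le> ennreal (d x y)" if "x \<in> Z" "y \<in> N x - {x}" for x y
  proof (cases "d x y \<le> s")
    case True
    then have "{x, y} \<in> ray_complex Z N d s" using that by (auto simp: ray_complex_def)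
    then have "?E x y" by (rule linked_simplex) auto
    then show ?thesis ..
  next
    case False
    then have "ennreal (d x y) \<in> W" using that unfolding W_def by (intro CollectI exI[of _ x] exI[of _ y]) auto
    then show ?thesis unfolding t_def using W by (intro disjI2 Min_le) auto
  qed
  have "separates ?E t (amalgam Z N d)"
    using N rays
    by (intro separates_amalgam) (auto intro!: reflpI transpI sympI intro: linked_trans linked_sym)
  moreover assume "\<not> ?E u v"
  moreover have "fst (amalgam Z N d) = Z" using N by (rule carrier_amalgam)
  ultimately have "t \<le> snd (amalgam Z N d) u v" using uv by (auto simp: separates_def)
  then show False using le \<open>ennreal s < t\<close> by simp
qed

theorem theorem27:
  fixes Z :: "'a set" and N :: "'a \<Rightarrow> 'a set" and d :: "'a \<Rightarrow> 'a \<Rightarrow> real" and s :: real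
  assumes "finite Z"
    and "\<And>x. x \<in> Z \<Longrightarrow> x \<in> N x \<and> N x \<subseteq> Z"
    and "\<And>x y. x \<in> Z \<Longrightarrow> y \<in> N x - {x} \<Longrightarrow> 0 < d x y"
    and "0 \<le> s"
  shows "ray_complex Z N d s \<subseteq> vietoris_rips (amalgam Z N d) s \<and>
         bij_betw (pi0_inclusion (vietoris_rips (amalgam Z N d) s))
           (pi0 (ray_complex Z N d s)) (pi0 (vietoris_rips (amalgam Z N d) s))"
proof
  let ?R = "ray_complex Z N d s" and ?V = "vietoris_rips (amalgam Z N d) s"
  have car: "fst (amalgam Z N d) = Z" using assms(2) by (rule carrier_amalgam)
  show sub: "?R \<subseteq> ?V" using assms(2) by (rule ray_complex_subset_vietoris_rips)
  show "bij_betw (pi0_inclusion ?V) (pi0 ?R) (pi0 ?V)"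
    using sub
  proof (rule bij_betw_pi0_inclusion)
    show "\<Union>?V \<subseteq> \<Union>?R" unfolding vietoris_rips_def ray_complex_def car by blast
    show "finite \<sigma>" if "\<sigma> \<in> ?V" for \<sigma> using that by (simp add: vietoris_rips_def)
    show "linked ?R u v" if "\<sigma> \<in> ?V" "u \<in> \<sigma>" "v \<in> \<sigma>" for \<sigma> u v
      using that
      by (intro linked_ray_complex_if_amalgam_le assms(1,2,4)) (auto simp: vietoris_rips_def car)
  qed
qed

end
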